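(* For every finite regular band $S$, the subpower membership problem $\mathrm{SMP}(S)$ is in $\mathrm{P}$.
   Context: A band is a semigroup in which every element is idempotent. For a word $v$, $\bar v$ denotes its dual word, i.e. $v$ with the order of its letters reversed; juxtaposition of words is concatenation. A band is called regular if it satisfies the identity $\bar G_3G_3\approx\bar I_3I_3$, where $$G_3=x_3x_1x_2,\qquad I_3=x_3x_1x_2x_3x_2x_1x_2 .$$ For a fixed finite semigroup $S$, $\mathrm{SMP}(S)$ is the following decision problem. Input: a positive integer $n$, tuples $a_1,\ldots,a_k\in S^n$ and $b\in S^n$. Question: is $b$ in the subsemigroup of $S^n$ generated by $\{a_1,\ldots,a_k\}$? The semigroup $S$ is not part of the input; the input size is essentially $(k+1)n$. *)

theory Defs
  imports Main "HOL-Computational_Algebra.Polynomial"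
begin

section \<open>Identities in semigroups; regular bands\<close>

text \<open>Words are nonempty lists of variables, the variable $x_i$ being the number \<open>i\<close>.
  Since a semigroup need not have an identity element, the value of the empty word is
  unspecified.\<close>

fun word_value :: "(nat \<Rightarrow> 'a::semigroup_mult) \<Rightarrow> nat list \<Rightarrow> 'a" where
  "word_value h [x] = h x"
| "word_value h (x # y # w) = h x * word_value h (y # w)"
| "word_value h [] = undefined"

definition satisfies_identity ::
    "'a::semigroup_mult itself \<Rightarrow> nat list \<Rightarrow> nat list \<Rightarrow> bool" where
  "satisfies_identity _ u v \<longleftrightarrow> (\<forall>h :: nat \<Rightarrow> 'a. word_value h u = word_value h v)"

definition band :: "'a::semigroup_mult itself \<Rightarrow> bool" where
  "band _ \<longleftrightarrow> (\<forall>x :: 'a. x * x = x)"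

definition G3 :: "nat list" where
  "G3 = [3, 1, 2]"

definition I3 :: "nat list" where
  "I3 = [3, 1, 2, 3, 2, 1, 2]"

definition regular_band :: "'a::semigroup_mult itself \<Rightarrow> bool" where
  "regular_band S \<longleftrightarrow> band S \<and> satisfies_identity S (rev G3 @ G3) (rev I3 @ I3)"


section \<open>The subpower membership problem\<close>

inductive_set subsemigroup_generated :: "('b \<Rightarrow> 'b \<Rightarrow> 'b) \<Rightarrow> 'b set \<Rightarrow> 'b set"
  for f :: "'b \<Rightarrow> 'b \<Rightarrow> 'b" and A :: "'b set" where
  base: "a \<in> A \<Longrightarrow> a \<in> subsemigroup_generated f A"
| mult: "x \<in> subsemigroup_generated f A \<Longrightarrow> y \<in> subsemigroup_generated f A \<Longrightarrow>
    f x y \<in> subsemigroup_generated f A"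

text \<open>An element of $S^n$ is a list of length \<open>n\<close>; on lists of equal length the following
  is the multiplication of the direct power.\<close>

definition tuple_mult :: "'a::semigroup_mult list \<Rightarrow> 'a list \<Rightarrow> 'a list" where
  "tuple_mult = map2 (*)"

text \<open>An instance with generators \<open>as\<close> and target \<open>b\<close> is written as the string
  $a_1 \# a_2 \# \cdots a_k \# b$ over the alphabet consisting of the elements of the semigroup
  (\<open>Some s\<close>) and one separator (\<open>None\<close>). The dimension \<open>n\<close> is not written separately since it
  is the length of \<open>b\<close>. The length of the string is $(k+1)n + k$.\<close>

definition encode_instance :: "'a list list \<Rightarrow> 'a list \<Rightarrow> 'a option list" where
  "encode_instance as b = concat (map (\<lambda>a. map Some a @ [None]) as) @ map Some b"

lemma encode_instance_inject:
  "encode_instance as b = encode_instance as' b' \<longleftrightarrow> as = as' \<and> b = b'"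
proof -
  have sep: "map Some a @ None # u = map Some a' @ None # u' \<longleftrightarrow> a = a' \<and> u = u'"
    for a a' :: "'a list" and u u'
    by (induction a arbitrary: a'; case_tac a') auto
  have no_sep: "map Some a @ None # u \<noteq> map Some c" for a c :: "'a list" and u
    by (metis ex_map_conv in_set_conv_decomp option.distinct(1))
  show ?thesis
  proof (induction as arbitrary: as')
    case Nil
    then show ?case
      by (cases as') (auto simp: encode_instance_def inj_map_eq_map no_sep[symmetric])
  next
    case (Cons a as)
    then show ?case
      by (cases as') (auto simp: encode_instance_def no_sep sep)
  qed
qed

definition SMP :: "'a::semigroup_mult option list set" where
  "SMP = {encode_instance as b | as b n.
     n > 0 \<and> length b = n \<and> (\<forall>a\<in>set as. length a = n) \<and>
     b \<in> subsemigroup_generated tuple_mult (set as)}"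


section \<open>Turing machines and polynomial time\<close>

text \<open>Deterministic Turing machines with a fixed number of two-way infinite tapes, for
  languages over a finite alphabet \<open>'c\<close>. The tape alphabet extends the input alphabet by the
  blank and by finitely many further symbols.\<close>

datatype 'c symbol = Blank | Letter 'c | Extra nat

datatype move = MoveLeft | Stay | MoveRight

text \<open>The states are the numbers below \<open>num_states\<close>, the further tape symbols are
  \<open>Extra i\<close> for \<open>i\<close> below \<open>num_extras\<close>. The transition function receives the state and the
  symbols under the heads, and yields the next state and, for each tape, the symbol to write
  and the head movement.\<close>

record 'c tm =
  num_tapes :: nat
  num_states :: nat
  num_extras :: nat
  start_state :: nat
  accept_state :: nat
  reject_state :: nat
  transition :: "nat \<Rightarrow> 'c symbol list \<Rightarrow> nat \<times> ('c symbol \<times> move) list"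

definition tape_alphabet :: "'c tm \<Rightarrow> 'c symbol set" where
  "tape_alphabet M = {Blank} \<union> range Letter \<union> Extra ` {..<num_extras M}"

definition turing_machine :: "'c tm \<Rightarrow> bool" where
  "turing_machine M \<longleftrightarrow>
     num_tapes M \<ge> 1 \<and>
     start_state M < num_states M \<and>
     accept_state M < num_states M \<and>
     reject_state M < num_states M \<and>
     accept_state M \<noteq> reject_state M \<and>
     (\<forall>q syms q' acts.
        q < num_states M \<and> length syms = num_tapes M \<and> set syms \<subseteq> tape_alphabet M \<and>
        transition M q syms = (q', acts) \<longrightarrow>
        q' < num_states M \<and> length acts = num_tapes M \<and> fst ` set acts \<subseteq> tape_alphabet M)"

text \<open>A tape is given by the contents of its cells and the position of the head.\<close>

type_synonym 'c tape = "(int \<Rightarrow> 'c symbol) \<times> int"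

type_synonym 'c config = "nat \<times> 'c tape list"

fun read_tape :: "'c tape \<Rightarrow> 'c symbol" where
  "read_tape (cells, pos) = cells pos"

fun move_head :: "move \<Rightarrow> int \<Rightarrow> int" where
  "move_head MoveLeft pos = pos - 1"
| "move_head Stay pos = pos"
| "move_head MoveRight pos = pos + 1"

fun act_tape :: "'c symbol \<times> move \<Rightarrow> 'c tape \<Rightarrow> 'c tape" where
  "act_tape (s, m) (cells, pos) = (cells(pos := s), move_head m pos)"

fun step :: "'c tm \<Rightarrow> 'c config \<Rightarrow> 'c config" where
  "step M (q, tapes) =
     (if q = accept_state M \<or> q = reject_state M then (q, tapes)
      else let (q', acts) = transition M q (map read_tape tapes)
           in (q', map2 act_tape acts tapes))"

definition input_tape :: "'c list \<Rightarrow> 'c tape" where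
  "input_tape w =
     (\<lambda>i. if 0 \<le> i \<and> i < int (length w) then Letter (w ! nat i) else Blank, 0)"

definition blank_tape :: "'c tape" where
  "blank_tape = (\<lambda>_. Blank, 0)"

definition initial_config :: "'c tm \<Rightarrow> 'c list \<Rightarrow> 'c config" where
  "initial_config M w =
     (start_state M, input_tape w # replicate (num_tapes M - 1) blank_tape)"

definition decides_in_time :: "'c tm \<Rightarrow> 'c list set \<Rightarrow> (nat \<Rightarrow> nat) \<Rightarrow> bool" where
  "decides_in_time M L T \<longleftrightarrow>
     (\<forall>w. \<exists>t \<le> T (length w).
        fst ((step M ^^ t) (initial_config M w)) =
          (if w \<in> L then accept_state M else reject_state M))"

definition class_P :: "'c::finite list set set" where
  "class_P = {L. \<exists>M (p :: nat poly). turing_machine M \<and> decides_in_time M L (poly p)}"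

end

theory Submission
  imports Defs
begin

text \<open>Adjoin an identity to the regular band \<open>S\<close>. The result is again a band with
  $xyzx = xyxzx$, and everything is computed in it coordinate by coordinate.

  Suppose that \<open>b\<close> is the product of a word \<open>w\<close> over the generators. In a regular band the
  value of a word is determined by the order of the first and the order of the last occurrences of
  its letters, and these two orders can be looked for independently: it suffices to find a product
  \<open>l\<close> of generators with \<open>l * b = b\<close> and a product \<open>r\<close> with \<open>b * r = b\<close>, each involving all
  letters of \<open>w\<close>; then \<open>l * r = b\<close> (\<open>stabilizers_factorize\<close>). Each of them can be found
  greedily. If \<open>p * b = b\<close> and \<open>p\<close> involves all letters of a prefix \<open>q\<close> of \<open>w\<close>, then the letter
  \<open>x\<close> that follows \<open>q\<close> in \<open>w\<close> also satisfies \<open>p * x * b = b\<close> (\<open>left_exchange\<close>), no matter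
  which other generators were multiplied to \<open>p\<close> before. So the following procedure never runs into
  a dead end: go through the generators again and again and multiply \<open>p\<close> by a generator whenever
  the result still fixes \<open>b\<close>. After more rounds than there are generators, \<open>p\<close> involves all
  letters of \<open>w\<close>. Hence \<open>b\<close> is generated if and only if the greedy left and right products
  satisfy \<open>l * r = b\<close> (\<open>generated_iff_greedy\<close>); one direction is trivial, as \<open>l * r\<close> is a
  product of generators.

  A Turing machine with three tapes carries this out in quadratic time. Its first tape holds the
  input. Cell \<open>j\<close> of the second tape holds the \<open>j\<close>-th coordinates of \<open>b\<close>, of \<open>l\<close>, of \<open>r\<close> and of
  the current generator, so that processing a generator is one pass over its block to the right,
  which evaluates the two tests, and one pass back to the left, which performs the
  multiplications. The third tape holds a copy of the input, whose only purpose is to count the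
  rounds. The machine is written as a program on pairs of lists, the two halves of a tape on the
  two sides of the head, and \<open>in_class_P_by_program\<close> transfers its analysis to the machine
  model.\<close>

section \<open>Regular bands with an identity adjoined\<close>

text \<open>The semigroup with an identity adjoined: \<open>None\<close> is the new identity. With it the product of a
  possibly empty word is \<open>prod_list\<close>.\<close>

instantiation option :: (semigroup_mult) monoid_mult
begin

definition one_option :: "'a option" where
  "one_option = None"

fun times_option :: "'a option \<Rightarrow> 'a option \<Rightarrow> 'a option" where
  "times_option None y = y"
| "times_option (Some x) None = Some x"
| "times_option (Some x) (Some y) = Some (x * y)"

instance
proof
  fix x y z :: "'a option"
  show "x * y * z = x * (y * z)"
    by (cases x; cases y; cases z) (simp_all add: mult.assoc)
  show "1 * x = x" "x * 1 = x"
    by (cases x; simp add: one_option_def)+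
qed

end

text \<open>The identity \<open>p * x * p = p\<close> says that \<open>x\<close> lies above \<open>p\<close> in the semilattice of the band, so
  the elements with this property are closed under products. The calculation compares the square
  of the idempotent \<open>c * p * a\<close> with that element itself.\<close>

lemma band_absorb_product:
  fixes p a c :: "'m::monoid_mult"
  assumes idem: "\<And>x::'m. x * x = x"
    and a: "p * a * p = p" and c: "p * c * p = p"
  shows "p * (a * c) * p = p"
proof -
  have "p * (a * c) * p = p * c * p * a * c * (p * a * p)"
    by (simp only: a c) (simp add: mult.assoc)
  also have "\<dots> = p * ((c * p * a) * (c * p * a)) * p"
    by (simp only: mult.assoc)
  also have "\<dots> = p * c * p * a * p"
    by (simp only: idem) (simp only: mult.assoc)
  also have "\<dots> = p"
    by (simp only: a c)
  finally show ?thesis .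
qed

lemma band_absorb_factor:
  fixes u a v :: "'m::monoid_mult"
  assumes idem: "\<And>x::'m. x * x = x"
  shows "(u * a * v) * a * (u * a * v) = u * a * v"
proof -
  \<comment> \<open>The factor \<open>a * (u * a) * v\<close> is idempotent; splitting off \<open>u * a\<close> from its square gives the claim.\<close>
  let ?x = "a * (u * a) * v"
  have ua: "u * a * a = u * a" "u * a * (u * a) = u * a"
    by (simp_all only: idem mult.assoc[of u a a])
  have "(u * a * v) * a * (u * a * v) = (u * a * a) * (u * a) * v * a * (u * a) * v"
    by (simp only: ua) (simp only: mult.assoc)
  also have "\<dots> = u * a * (?x * ?x)"
    by (simp only: mult.assoc)
  also have "\<dots> = (u * a * a) * (u * a) * v"
    by (simp only: idem) (simp only: mult.assoc)
  finally show ?thesis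
    by (simp only: ua)
qed

text \<open>That a word involves all letters of another one enters the later arguments only through this
  absorption law. It holds in every band, regular or not.\<close>

lemma band_absorb_word:
  fixes s w :: "'m::monoid_mult list"
  assumes idem: "\<And>x::'m. x * x = x" and "set s \<subseteq> set w"
  shows "prod_list w * prod_list s * prod_list w = prod_list w"
  using assms(2)
proof (induction s)
  case Nil
  then show ?case by (simp add: idem)
next
  case (Cons a s)
  then obtain u v where "w = u @ a # v"
    by (auto dest: split_list)
  then have "prod_list w * a * prod_list w = prod_list w"
    using band_absorb_factor[OF idem, of "prod_list u" a "prod_list v"] by (simp add: mult.assoc)
  then show ?case
    using Cons by (simp add: band_absorb_product[OF idem])
qed

text \<open>The identity \<open>law\<close> is $\bar G_3 G_3 \approx \bar I_3 I_3$. To derive the usual identity of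
  regular bands, note that the two sides of \<open>law\<close> begin with \<open>y * x * z\<close> and \<open>y * x * y * z\<close>;
  absorption makes these two elements \<open>\<R>\<close>-related. The identity is its own dual, so \<open>z * x * y\<close>
  and \<open>z * y * x * y\<close> are \<open>\<L>\<close>-related. Hence \<open>a * b * c * a\<close> and \<open>a * b * a * c * a\<close> are
  related in both ways, and in a band that makes them equal.\<close>

lemma regular_law_of_identity:
  fixes a b c :: "'m::monoid_mult"
  assumes idem: "\<And>x::'m. x * x = x"
    and law: "\<And>x y z::'m. y * x * z * x * y = y * x * y * z * y * x * z * x * y * z * y * x * y"
  shows "a * b * c * a = a * b * a * c * a"
proof -
  note absorb = band_absorb_word[OF idem]
  let ?p = "a * b * c * a" and ?q = "a * b * a * c * a"
  have "?q * ?p = ?p"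
  proof -
    let ?t = "a * b * c * b * a * c * a * b * a"
    have "?p = (a * b * c * b * a) * ?p"
      using absorb[of "[b, a]" "[a, b, c]"] by (simp add: mult.assoc[symmetric])
    also have "\<dots> = a * b * a * c * ?t * ?p"
      by (subst law[of a b c]) (simp only: mult.assoc)
    finally have p: "?p = a * b * a * c * ?t * ?p" .
    have "?q * ?p = (a * b * a * c * a * (a * b * a * c)) * ?t * ?p"
      by (subst p) (simp only: mult.assoc)
    also have "\<dots> = a * b * a * c * ?t * ?p"
      using absorb[of "[a]" "[a, b, a, c]"] by (simp add: mult.assoc[symmetric])
    also have "\<dots> = ?p"
      by (rule p[symmetric])
    finally show ?thesis .
  qed
  moreover have "?p * ?q = ?p"
  proof -
    let ?t = "a * c * a * b * a * c * b * c * a"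
    have "?p = ?p * (a * c * b * c * a)"
      using absorb[of "[a, c]" "[b, c, a]"] by (simp add: mult.assoc)
    also have "\<dots> = ?p * ?t * (b * a * c * a)"
      by (subst law[of a c b]) (simp only: mult.assoc)
    finally have p: "?p = ?p * ?t * (b * a * c * a)" .
    have "?p * ?q = ?p * ?t * (b * a * c * a * a * (b * a * c * a))"
      by (subst p) (simp only: mult.assoc)
    also have "\<dots> = ?p * ?t * (b * a * c * a)"
      using absorb[of "[a]" "[b, a, c, a]"] by (simp add: mult.assoc)
    also have "\<dots> = ?p"
      by (rule p[symmetric])
    finally show ?thesis .
  qed
  moreover have "?q * ?p * ?q = ?q"
    using absorb[of "[a, b, c, a]" "[a, b, a, c, a]"] by (simp add: mult.assoc)
  ultimately show ?thesis by simp
qed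

lemma adjoined_one_regular:
  assumes "regular_band TYPE('a::semigroup_mult)"
  shows "x * x = (x :: 'a option)"
    and "x * y * z * x = x * y * x * z * (x :: 'a option)"
proof -
  have idem: "s * s = s" for s :: 'a
    using assms by (simp add: regular_band_def band_def)
  have idem': "s * (s * t) = s * t" for s t :: 'a
    using idem[of s] by (simp add: mult.assoc[symmetric])
  have idem_opt: "u * u = u" for u :: "'a option"
    by (cases u) (simp_all add: idem)
  then show "x * x = x" .
  \<comment> \<open>The semigroup satisfies the identity; with the new identity element in place of a
    variable, both sides collapse to the same square-free word.\<close>
  have law: "t * s * r * s * t = t * s * t * r * t * s * r * s * t * r * t * s * t" for r s t :: 'a
  proof -
    define h where "h = (\<lambda>i::nat. if i = 1 then s else if i = 2 then t else r)"
    have "t * s * r * s * t = word_value h (rev G3 @ G3)"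
      by (simp add: G3_def h_def mult.assoc idem')
    also have "\<dots> = word_value h (rev I3 @ I3)"
      using assms by (simp add: regular_band_def satisfies_identity_def)
    also have "\<dots> = t * s * t * r * t * s * r * s * t * r * t * s * t"
      by (simp add: I3_def h_def mult.assoc idem')
    finally show ?thesis .
  qed
  have "t * s * r * s * t = t * s * t * r * t * s * r * s * t * r * t * s * t" for r s t :: "'a option"
  proof -
    have dup: "v * s * v * s = v * s" "v * (s * (v * s)) = v * s" 
      "v * (s * (v * (s * r))) = v * (s * r)" for v s r :: 'a
      using idem[of "v * s"] by (metis mult.assoc)+
    show ?thesis
    proof (cases "r = None \<or> s = None \<or> t = None")
      case True
      then show ?thesis
        by (cases r; cases s; cases t) (simp_all add: idem idem' dup mult.assoc)
    next
      case False
      then obtain r' s' t' where "r = Some r'" "s = Some s'" "t = Some t'"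
        by auto
      then show ?thesis
        by (simp only: times_option.simps law[of t' s' r', symmetric])
    qed
  qed
  then show "x * y * z * x = x * y * x * z * x"
    using regular_law_of_identity[OF idem_opt] by blast
qed

text \<open>The step that makes the greedy choice work. Here \<open>q\<close> is a prefix of a word with value \<open>b\<close>, \<open>x\<close>
  is its next letter, and \<open>p\<close> is any product that fixes \<open>b\<close> and involves all letters of \<open>q\<close>:
  inserting \<open>p\<close> before and after \<open>q * x\<close> does not change \<open>q * x * b\<close>, and then \<open>q\<close> is absorbed
  by \<open>p\<close>.\<close>

lemma left_exchange:
  fixes p q x b :: "'m::monoid_mult"
  assumes regular: "\<And>x y z::'m. x * y * z * x = x * y * x * z * x"
    and "p * b = b" "q * x * b = b" "p * q * p = p"
  shows "p * x * b = b"
proof -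
  have "b = p * (q * x * (p * b))"
    using assms by simp
  also have "\<dots> = (p * q * x * p) * b"
    by (simp only: mult.assoc)
  also have "\<dots> = (p * q * p) * x * (p * b)"
    by (simp only: regular) (simp only: mult.assoc)
  finally show ?thesis
    using assms by simp
qed

lemma right_exchange:
  fixes p q x b :: "'m::monoid_mult"
  assumes regular: "\<And>x y z::'m. x * y * z * x = x * y * x * z * x"
    and "b * p = b" "b * (x * q) = b" "p * q * p = p"
  shows "b * (x * p) = b"
proof -
  have "b = (b * p) * (x * q) * p"
    using assms by simp
  also have "\<dots> = b * (p * x * q * p)"
    by (simp only: mult.assoc)
  also have "\<dots> = (b * p) * x * (p * q * p)"
    by (simp only: regular) (simp only: mult.assoc)
  finally show ?thesis
    using assms by (simp add: mult.assoc)
qed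

text \<open>The last two assumptions hold when \<open>l\<close> and \<open>r\<close> involve all letters of a word with value \<open>b\<close>.
  They give \<open>b * l = l\<close> and \<open>r * b = r\<close>, so that \<open>l * r\<close> is unchanged by multiplication with
  \<open>b\<close> on both sides; there regularity separates \<open>l\<close> from \<open>r\<close>.\<close>

lemma stabilizers_factorize:
  fixes l r b :: "'m::monoid_mult"
  assumes idem: "\<And>x::'m. x * x = x"
    and regular: "\<And>x y z::'m. x * y * z * x = x * y * x * z * x"
    and "l * b = b" "b * r = b" "l * b * l = l" "r * b * r = r"
  shows "l * r = b"
proof -
  \<comment> \<open>\<open>l * b * l = l\<close> and \<open>l * b = b\<close> give \<open>b * l = l\<close>, and dually.\<close>
  have bl: "b * l = l" and rb: "r * b = r"
    using assms by (auto simp: mult.assoc)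
  then have "l * r = b * l * r * b"
    by (simp add: mult.assoc)
  also have "\<dots> = b * (l * b) * (r * b)"
    using regular[of b l r] by (simp add: mult.assoc)
  also have "\<dots> = b"
    by (simp only: assms(3,4) idem mult.assoc[symmetric])
  finally show ?thesis .
qed


section \<open>Greedy choice of the generators\<close>

text \<open>A word of tuples is evaluated in one coordinate at a time: in the power itself the empty word
  would have no value of a fixed length.\<close>

abbreviation coord_prod :: "nat \<Rightarrow> 'a::semigroup_mult list list \<Rightarrow> 'a option" where
  "coord_prod j u \<equiv> prod_list (map (\<lambda>a. Some (a ! j)) u)"

lemma generated_iff_word:
  fixes b :: "'a::semigroup_mult list"
  assumes "\<forall>a\<in>A. length a = n" "length b = n"
  shows "b \<in> subsemigroup_generated tuple_mult A \<longleftrightarrow>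
    (\<exists>w. w \<noteq> [] \<and> set w \<subseteq> A \<and> (\<forall>j<n. coord_prod j w = Some (b ! j)))"
proof
  assume "b \<in> subsemigroup_generated tuple_mult A"
  then have "length b = n \<and>
    (\<exists>w. w \<noteq> [] \<and> set w \<subseteq> A \<and> (\<forall>j<n. coord_prod j w = Some (b ! j)))"
  proof induction
    case (base a)
    then show ?case
      using assms by (intro conjI exI[of _ "[a]"]) auto
  next
    case (mult x y)
    then obtain w1 w2 where w: "w1 \<noteq> []" "set w1 \<subseteq> A" "\<forall>j<n. coord_prod j w1 = Some (x ! j)"
      "w2 \<noteq> []" "set w2 \<subseteq> A" "\<forall>j<n. coord_prod j w2 = Some (y ! j)"
      by blast
    then show ?case
      using mult by (intro conjI exI[of _ "w1 @ w2"]) (auto simp: tuple_mult_def)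
  qed
  then show "\<exists>w. w \<noteq> [] \<and> set w \<subseteq> A \<and> (\<forall>j<n. coord_prod j w = Some (b ! j))"
    by blast
next
  have "b \<in> subsemigroup_generated tuple_mult A"
    if "w \<noteq> []" "set w \<subseteq> A" "\<forall>j<n. coord_prod j w = Some (b ! j)" "length b = n" for w
    using that
  proof (induction w arbitrary: b rule: list_nonempty_induct)
    case (single a)
    then have "b = a"
      using assms by (auto intro!: nth_equalityI)
    then show ?case
      using single by (auto intro: subsemigroup_generated.base)
  next
    case (cons a w)
    have ne: "coord_prod j w \<noteq> None" for j
      using cons(1) by (cases w; cases "coord_prod j (tl w)") auto
    define c where "c = map (\<lambda>j. the (coord_prod j w)) [0..<n]"
    have c: "\<forall>j<n. coord_prod j w = Some (c ! j)"
      using ne by (auto simp: c_def)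
    moreover have "length c = n"
      by (simp add: c_def)
    ultimately have "c \<in> subsemigroup_generated tuple_mult A"
      using cons.IH cons.prems(1) by simp
    moreover have "b = tuple_mult a c"
    proof (rule nth_equalityI)
      show "length b = length (tuple_mult a c)"
        using cons.prems assms by (simp add: tuple_mult_def c_def)
      fix j
      assume "j < length b"
      then have "j < n" "Some (a ! j) * Some (c ! j) = Some (b ! j)"
        using cons.prems c by auto
      then show "b ! j = tuple_mult a c ! j"
        using cons.prems assms by (simp add: tuple_mult_def c_def)
    qed
    moreover have "a \<in> subsemigroup_generated tuple_mult A"
      using cons.prems(1) by (simp add: subsemigroup_generated.base)
    ultimately show ?case
      using subsemigroup_generated.mult by metis
  qed
  then show "\<exists>w. w \<noteq> [] \<and> set w \<subseteq> A \<and> (\<forall>j<n. coord_prod j w = Some (b ! j)) \<Longrightarrow>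
    b \<in> subsemigroup_generated tuple_mult A"
    using assms(2) by blast
qed

text \<open>Both products are built by the same procedure, which extends a word at its end as long as a
  predicate \<open>ok\<close> permits it. For the right product, which grows to the left, the word is the
  reversed one.\<close>

definition try_append :: "('x list \<Rightarrow> bool) \<Rightarrow> 'x list \<Rightarrow> 'x \<Rightarrow> 'x list" where
  "try_append ok u a = (if ok (u @ [a]) then u @ [a] else u)"

definition greedy_word :: "('x list \<Rightarrow> bool) \<Rightarrow> 'x list \<Rightarrow> nat \<Rightarrow> 'x list" where
  "greedy_word ok as N = ((\<lambda>u. foldl (try_append ok) u as) ^^ N) []"

lemma foldl_try_append:
  assumes "ok u"
  shows "ok (foldl (try_append ok) u as)"
    and "set u \<subseteq> set (foldl (try_append ok) u as)"
    and "set (foldl (try_append ok) u as) \<subseteq> set u \<union> set as"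
proof -
  have "ok (foldl (try_append ok) u as) \<and> set u \<subseteq> set (foldl (try_append ok) u as) \<and>
    set (foldl (try_append ok) u as) \<subseteq> set u \<union> set as"
    using assms
  proof (induction as arbitrary: u)
    case (Cons a as)
    have "ok (try_append ok u a)" "set u \<subseteq> set (try_append ok u a)"
      "set (try_append ok u a) \<subseteq> insert a (set u)"
      using Cons.prems by (auto simp: try_append_def)
    then show ?case
      using Cons.IH[of "try_append ok u a"] by auto
  qed simp
  then show "ok (foldl (try_append ok) u as)"
    and "set u \<subseteq> set (foldl (try_append ok) u as)"
    and "set (foldl (try_append ok) u as) \<subseteq> set u \<union> set as"
    by auto
qed

lemma greedy_word_ok:
  assumes "ok []"
  shows "ok (greedy_word ok as N)" "set (greedy_word ok as N) \<subseteq> set as"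
proof -
  have "ok (greedy_word ok as N) \<and> set (greedy_word ok as N) \<subseteq> set as"
  proof (induction N)
    case (Suc N)
    then show ?case
      using foldl_try_append[of ok "greedy_word ok as N" as] by (auto simp: greedy_word_def)
  qed (simp add: greedy_word_def assms)
  then show "ok (greedy_word ok as N)" "set (greedy_word ok as N) \<subseteq> set as"
    by auto
qed

text \<open>Every round that starts with a letter of \<open>T\<close> missing adds a new generator: the letter \<open>x\<close> that is
  appendable at the beginning of the round stays appendable until it is reached. So the number of
  rounds in which a letter is missing is bounded by the number of generators.\<close>

lemma greedy_word_covers:
  assumes "ok []" and "T \<subseteq> set as" and "length as < N"
    and extend: "\<And>u. ok u \<Longrightarrow> \<not> T \<subseteq> set u \<Longrightarrow>
      \<exists>x\<in>T - set u. \<forall>u'. ok u' \<longrightarrow> set u \<subseteq> set u' \<longrightarrow> ok (u' @ [x])"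
  shows "T \<subseteq> set (greedy_word ok as N)"
proof -
  have "T \<subseteq> set (greedy_word ok as i) \<or> i \<le> card (set (greedy_word ok as i))" for i
  proof (induction i)
    case (Suc i)
    let ?u = "greedy_word ok as i"
    have ok: "ok ?u"
      using greedy_word_ok assms(1) by blast
    have next_word: "greedy_word ok as (Suc i) = foldl (try_append ok) ?u as"
      by (simp add: greedy_word_def)
    show ?case
    proof (cases "T \<subseteq> set ?u")
      case True
      then show ?thesis
        using foldl_try_append(2)[of ok ?u as, OF ok] next_word by auto
    next
      case False
      then obtain x where x: "x \<in> T" "x \<notin> set ?u"
        and appendable: "\<And>u'. ok u' \<Longrightarrow> set ?u \<subseteq> set u' \<Longrightarrow> ok (u' @ [x])"
        using extend[OF ok] by blast
      then obtain as1 as2 where as: "as = as1 @ x # as2"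
        using assms(2) by (meson split_list subsetD)
      \<comment> \<open>The word at the moment when the round reaches \<open>x\<close>.\<close>
      define v where "v = foldl (try_append ok) ?u as1"
      have v: "ok v" "set ?u \<subseteq> set v"
        using foldl_try_append[of ok ?u as1, OF ok] by (simp_all add: v_def)
      then have "greedy_word ok as (Suc i) = foldl (try_append ok) (v @ [x]) as2"
        using appendable unfolding next_word by (simp add: as v_def try_append_def)
      then have "insert x (set ?u) \<subseteq> set (greedy_word ok as (Suc i))"
        using foldl_try_append(2)[of ok "v @ [x]" as2] appendable v by auto
      then have "card (insert x (set ?u)) \<le> card (set (greedy_word ok as (Suc i)))"
        by (rule card_mono[rotated]) simp
      then show ?thesis
        using x False Suc by auto
    qed
  qed simp
  moreover have "card (set (greedy_word ok as N)) \<le> card (set as)"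
    using greedy_word_ok(2)[of ok as N] assms(1) by (simp add: card_mono)
  ultimately show ?thesis
    using card_length[of as] assms(3) by (metis le_trans not_le)
qed

definition left_stable :: "'a::semigroup_mult list \<Rightarrow> 'a list list \<Rightarrow> bool" where
  "left_stable b u \<longleftrightarrow> (\<forall>j<length b. coord_prod j u * Some (b ! j) = Some (b ! j))"

definition right_stable :: "'a::semigroup_mult list \<Rightarrow> 'a list list \<Rightarrow> bool" where
  "right_stable b u \<longleftrightarrow> (\<forall>j<length b. Some (b ! j) * coord_prod j (rev u) = Some (b ! j))"

lemma stable_empty: "left_stable b []" "right_stable b []"
  by (simp_all add: left_stable_def right_stable_def)

definition greedy_left :: "'a::semigroup_mult list list \<Rightarrow> 'a list \<Rightarrow> nat \<Rightarrow> 'a list list" where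
  "greedy_left as b N = greedy_word (left_stable b) as N"

definition greedy_right :: "'a::semigroup_mult list list \<Rightarrow> 'a list \<Rightarrow> nat \<Rightarrow> 'a list list" where
  "greedy_right as b N = greedy_word (right_stable b) as N"

lemma greedy_left_covers:
  fixes w :: "'a::semigroup_mult list list"
  assumes "regular_band TYPE('a)"
    and w: "\<forall>j<length b. coord_prod j w = Some (b ! j)"
    and "set w \<subseteq> set as" "length as < N"
  shows "set w \<subseteq> set (greedy_left as b N)"
  unfolding greedy_left_def
proof (rule greedy_word_covers)
  note band = adjoined_one_regular[OF assms(1)]
  fix u
  assume "\<not> set w \<subseteq> set u"
  then obtain q x r where split: "w = q @ x # r" "x \<notin> set u" "set q \<subseteq> set u"
    using split_list_first_prop[of w "\<lambda>x. x \<notin> set u"] by blast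
  have "left_stable b (u' @ [x])" if u': "left_stable b u'" "set u \<subseteq> set u'" for u'
    unfolding left_stable_def
  proof (intro allI impI)
    fix j
    assume j: "j < length b"
    let ?Q = "coord_prod j q" and ?X = "Some (x ! j)" and ?R = "coord_prod j r"
    have b: "Some (b ! j) = (?Q * ?X) * ?R"
      using w[rule_format, OF j] by (simp add: split mult.assoc)
    have "?Q * ?X * Some (b ! j) = Some (b ! j)"
      by (simp only: b band(1) mult.assoc[symmetric, of "?Q * ?X" "?Q * ?X"])
    moreover have "coord_prod j u' * ?Q * coord_prod j u' = coord_prod j u'"
      using split u' by (intro band_absorb_word[OF band(1)]) auto
    moreover have "coord_prod j u' * Some (b ! j) = Some (b ! j)"
      using u' j by (simp add: left_stable_def)
    ultimately have "coord_prod j u' * ?X * Some (b ! j) = Some (b ! j)"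
      using left_exchange[OF band(2)] by blast
    then show "coord_prod j (u' @ [x]) * Some (b ! j) = Some (b ! j)"
      by simp
  qed
  moreover have "x \<in> set w"
    using split by simp
  ultimately show "\<exists>x\<in>set w - set u. \<forall>u'. left_stable b u' \<longrightarrow> set u \<subseteq> set u' \<longrightarrow>
      left_stable b (u' @ [x])"
    using split by blast
qed (use assms stable_empty in auto)

text \<open>The mirror image: now \<open>x\<close> is the last letter of \<open>w\<close> that is missing, and the suffix after it is
  absorbed.\<close>

lemma greedy_right_covers:
  fixes w :: "'a::semigroup_mult list list"
  assumes "regular_band TYPE('a)"
    and w: "\<forall>j<length b. coord_prod j w = Some (b ! j)"
    and "set w \<subseteq> set as" "length as < N"
  shows "set w \<subseteq> set (greedy_right as b N)"
  unfolding greedy_right_def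
proof (rule greedy_word_covers)
  note band = adjoined_one_regular[OF assms(1)]
  fix u
  assume "\<not> set w \<subseteq> set u"
  then obtain r x q where split: "w = r @ x # q" "x \<notin> set u" "set q \<subseteq> set u"
    using split_list_last_prop[of w "\<lambda>x. x \<notin> set u"] by blast
  have "right_stable b (u' @ [x])" if u': "right_stable b u'" "set u \<subseteq> set u'" for u'
    unfolding right_stable_def
  proof (intro allI impI)
    fix j
    assume j: "j < length b"
    let ?Q = "coord_prod j q" and ?X = "Some (x ! j)" and ?R = "coord_prod j r"
    have b: "Some (b ! j) = ?R * (?X * ?Q)"
      using w[rule_format, OF j] by (simp add: split mult.assoc)
    have "Some (b ! j) * (?X * ?Q) = Some (b ! j)"
      by (simp only: b band(1) mult.assoc[of _ "?X * ?Q" "?X * ?Q"])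
    moreover have "coord_prod j (rev u') * ?Q * coord_prod j (rev u') = coord_prod j (rev u')"
      using split u' by (intro band_absorb_word[OF band(1)]) auto
    moreover have "Some (b ! j) * coord_prod j (rev u') = Some (b ! j)"
      using u' j by (simp add: right_stable_def)
    ultimately have "Some (b ! j) * (?X * coord_prod j (rev u')) = Some (b ! j)"
      using right_exchange[OF band(2)] by blast
    then show "Some (b ! j) * coord_prod j (rev (u' @ [x])) = Some (b ! j)"
      by simp
  qed
  moreover have "x \<in> set w"
    using split by simp
  ultimately show "\<exists>x\<in>set w - set u. \<forall>u'. right_stable b u' \<longrightarrow> set u \<subseteq> set u' \<longrightarrow>
      right_stable b (u' @ [x])"
    using split by blast
qed (use assms stable_empty in auto)

theorem generated_iff_greedy:
  fixes b :: "'a::semigroup_mult list"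
  assumes "regular_band TYPE('a)" and "b \<noteq> []" and "\<forall>a\<in>set as. length a = length b"
    and "length as < N"
  shows "b \<in> subsemigroup_generated tuple_mult (set as) \<longleftrightarrow>
    (\<forall>j<length b. coord_prod j (greedy_left as b N) * coord_prod j (rev (greedy_right as b N)) =
      Some (b ! j))"
proof -
  note band = adjoined_one_regular[OF assms(1)]
  let ?u = "greedy_left as b N" and ?v = "rev (greedy_right as b N)"
  have "coord_prod j ?u * coord_prod j ?v = Some (b ! j)"
    if w: "set w \<subseteq> set as" "\<forall>j<length b. coord_prod j w = Some (b ! j)" and j: "j < length b"
    for w j
  proof (rule stabilizers_factorize[OF band])
    have "left_stable b ?u" "right_stable b (greedy_right as b N)"
      by (simp_all add: greedy_left_def greedy_right_def greedy_word_ok(1) stable_empty)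
    then show "coord_prod j ?u * Some (b ! j) = Some (b ! j)"
      "Some (b ! j) * coord_prod j ?v = Some (b ! j)"
      using j by (simp_all add: left_stable_def right_stable_def)
    have "coord_prod j ?u * coord_prod j w * coord_prod j ?u = coord_prod j ?u"
      using greedy_left_covers[OF assms(1) w(2) w(1) assms(4)]
      by (intro band_absorb_word[OF band(1)]) (simp add: image_mono)
    then show "coord_prod j ?u * Some (b ! j) * coord_prod j ?u = coord_prod j ?u"
      using w j by simp
    have "coord_prod j ?v * coord_prod j w * coord_prod j ?v = coord_prod j ?v"
      using greedy_right_covers[OF assms(1) w(2) w(1) assms(4)]
      by (intro band_absorb_word[OF band(1)]) (simp add: image_mono)
    then show "coord_prod j ?v * Some (b ! j) * coord_prod j ?v = coord_prod j ?v"
      using w j by simp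
  qed
  moreover have "\<exists>w. w \<noteq> [] \<and> set w \<subseteq> set as \<and> (\<forall>j<length b. coord_prod j w = Some (b ! j))"
    if "\<forall>j<length b. coord_prod j ?u * coord_prod j ?v = Some (b ! j)"
  proof (intro exI conjI)
    \<comment> \<open>An empty word would give the adjoined identity in each coordinate, and there is at least
      one coordinate.\<close>
    show "?u @ ?v \<noteq> []"
      using that assms(2) by (auto simp: one_option_def)
    show "set (?u @ ?v) \<subseteq> set as"
      using greedy_word_ok(2)[of "left_stable b" as N] greedy_word_ok(2)[of "right_stable b" as N]
        stable_empty unfolding greedy_left_def greedy_right_def by auto
    show "\<forall>j<length b. coord_prod j (?u @ ?v) = Some (b ! j)"
      using that by simp
  qed
  ultimately show ?thesis
    unfolding generated_iff_word[OF assms(3) refl] by blast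
qed


section \<open>Three-tape programs on lists\<close>

text \<open>States and tape symbols of the machine model are numbers, whereas the program uses finite types.\<close>

definition code :: "'x::finite \<Rightarrow> nat" where
  "code = (SOME f. bij_betw f UNIV {..<card (UNIV :: 'x set)})"

definition decode :: "nat \<Rightarrow> 'x::finite" where
  "decode = inv code"

lemma code_bij: "bij_betw (code :: 'x::finite \<Rightarrow> nat) UNIV {..<card (UNIV :: 'x set)}"
proof -
  have "\<exists>f :: 'x \<Rightarrow> nat. bij_betw f UNIV {..<card (UNIV :: 'x set)}"
    using ex_bij_betw_finite_nat[of "UNIV :: 'x set"] by (simp add: atLeast0LessThan)
  then show ?thesis
    unfolding code_def by (rule someI_ex)
qed

lemma code_less: "code (x :: 'x::finite) < card (UNIV :: 'x set)"
  using code_bij[where 'x = 'x] by (auto simp: bij_betw_def)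

lemma decode_code [simp]: "decode (code (x :: 'x::finite)) = x"
  using code_bij[where 'x = 'x] by (auto simp: decode_def bij_betw_def)

text \<open>A tape as seen from its head: the cells to the left of the head, the nearest one first, and the
  cells from the head on to the right. Both lists end where only blanks follow; \<open>push\<close> keeps this
  normal form, so that running over a tape and back restores equal lists.\<close>

type_synonym 'c half_tapes = "'c symbol list \<times> 'c symbol list"

fun first :: "'c symbol list \<Rightarrow> 'c symbol" where
  "first [] = Blank"
| "first (s # xs) = s"

definition push :: "'c symbol \<Rightarrow> 'c symbol list \<Rightarrow> 'c symbol list" where
  "push s xs = (if s = Blank \<and> xs = [] then [] else s # xs)"

definition cell_at :: "'c symbol list \<Rightarrow> nat \<Rightarrow> 'c symbol" where
  "cell_at xs k = (if k < length xs then xs ! k else Blank)"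

fun move_left :: "'c half_tapes \<Rightarrow> 'c half_tapes" where
  "move_left (ls, rs) = (tl ls, push (first ls) rs)"

fun act_halves :: "'c symbol \<times> move \<Rightarrow> 'c half_tapes \<Rightarrow> 'c half_tapes" where
  "act_halves (s, MoveLeft) (ls, rs) = move_left (ls, push s (tl rs))"
| "act_halves (s, Stay) (ls, rs) = (ls, push s (tl rs))"
| "act_halves (s, MoveRight) (ls, rs) = (push s ls, tl rs)"

fun read_halves :: "'c half_tapes \<Rightarrow> 'c symbol" where
  "read_halves (ls, rs) = first rs"

fun represents :: "'c half_tapes \<Rightarrow> 'c tape \<Rightarrow> bool" where
  "represents (ls, rs) (cells, pos) \<longleftrightarrow>
    (\<forall>k. cells (pos + int k) = cell_at rs k \<and> cells (pos - 1 - int k) = cell_at ls k)"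

lemma cell_at_push: "cell_at (push s xs) k = (if k = 0 then s else cell_at xs (k - 1))"
  by (cases k) (auto simp: push_def cell_at_def)

lemma cell_at_tl: "cell_at (tl xs) k = cell_at xs (Suc k)"
  by (cases xs) (auto simp: cell_at_def)

lemma first_cell_at: "first xs = cell_at xs 0"
  by (cases xs) (auto simp: cell_at_def)

lemma represents_read: "represents h t \<Longrightarrow> read_tape t = read_halves h"
  by (cases h; cases t) (auto simp: first_cell_at dest: spec[of _ 0])

text \<open>The relation \<open>represents\<close> leaves the position of the head free, since no transition depends on
  it. It contains the only reasoning about integer positions.\<close>

lemma represents_act:
  assumes "represents h t"
  shows "represents (act_halves a h) (act_tape a t)"
proof -
  obtain ls rs cells pos where eq: "h = (ls, rs)" "t = (cells, pos)"
    by (metis surj_pair)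
  have R: "cells (pos + int k) = cell_at rs k" and L: "cells (pos - 1 - int k) = cell_at ls k" for k
    using assms by (simp_all add: eq)
  have R': "cells (pos + i) = cell_at rs (nat i)" if "i \<ge> 0" for i
    using R[of "nat i"] that by simp
  have L': "cells (pos - i) = cell_at ls (nat (i - 1))" if "i \<ge> 1" for i
    using L[of "nat (i - 1)"] that by (simp add: algebra_simps)
  obtain s m where a: "a = (s, m)"
    by (cases a)
  have 1: "(cells(pos := s)) (pos + i) = cell_at (push s (tl rs)) (nat i)" if "i \<ge> 0" for i
    using R'[OF that] that
    by (auto simp: cell_at_push cell_at_tl nat_diff_distrib
        intro: arg_cong[of _ _ "cell_at rs"])
  have 2: "(cells(pos := s)) (pos - i) = cell_at ls (nat (i - 1))" if "i \<ge> 1" for i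
    using L'[OF that] that by simp
  show ?thesis
  proof (cases m)
    case MoveLeft
    have "(cells(pos := s)) (pos - 1 + int k) = cell_at (push (first ls) (push s (tl rs))) k" for k
    proof (cases k)
      case 0
      then show ?thesis
        using 2[of 1] by (simp add: cell_at_push first_cell_at)
    next
      case (Suc k')
      then show ?thesis
        using 1[of "int k'"] by (simp add: cell_at_push[of "first ls"])
    qed
    moreover have "(cells(pos := s)) (pos - 1 - 1 - int k) = cell_at (tl ls) k" for k
      using 2[of "int k + 2"]
      by (simp add: cell_at_tl algebra_simps nat_add_distrib)
    ultimately show ?thesis
      by (simp add: eq a MoveLeft del: fun_upd_apply)
  next
    case Stay
    then show ?thesis
      using 1[of "int _"] 2[of "int _ + 1"]
      by (simp add: eq a algebra_simps del: fun_upd_apply)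
  next
    case MoveRight
    have "(cells(pos := s)) (pos + 1 + int k) = cell_at (tl rs) k" for k
      using 1[of "int k + 1"]
      by (simp add: cell_at_push algebra_simps nat_add_distrib)
    moreover have "(cells(pos := s)) (pos + 1 - 1 - int k) = cell_at (push s ls) k" for k
      using 1[of 0] 2[of "int k"]
      by (cases k) (simp_all add: cell_at_push)
    ultimately show ?thesis
      by (simp add: eq a MoveRight del: fun_upd_apply)
  qed
qed

type_synonym ('q, 'c) program =
  "'q \<Rightarrow> 'c symbol \<Rightarrow> 'c symbol \<Rightarrow> 'c symbol \<Rightarrow>
    'q \<times> ('c symbol \<times> move) \<times> ('c symbol \<times> move) \<times> ('c symbol \<times> move)"

type_synonym ('q, 'c) program_config = "'q \<times> 'c half_tapes \<times> 'c half_tapes \<times> 'c half_tapes"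

fun program_step ::
    "('q, 'c) program \<Rightarrow> 'q \<Rightarrow> 'q \<Rightarrow> ('q, 'c) program_config \<Rightarrow> ('q, 'c) program_config" where
  "program_step \<delta> acc rej (q, h1, h2, h3) =
    (if q = acc \<or> q = rej then (q, h1, h2, h3)
     else case \<delta> q (read_halves h1) (read_halves h2) (read_halves h3) of
       (q', a1, a2, a3) \<Rightarrow> (q', act_halves a1 h1, act_halves a2 h2, act_halves a3 h3))"

definition machine_of ::
    "('q::finite, 'c) program \<Rightarrow> 'q \<Rightarrow> 'q \<Rightarrow> 'q \<Rightarrow> nat \<Rightarrow> 'c tm" where
  "machine_of \<delta> start acc rej extras =
    \<lparr>num_tapes = 3, num_states = card (UNIV :: 'q set), num_extras = extras,
     start_state = code start, accept_state = code acc, reject_state = code rej,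
     transition = \<lambda>q syms. case \<delta> (decode q) (syms ! 0) (syms ! 1) (syms ! 2) of
       (q', a1, a2, a3) \<Rightarrow> (code q', [a1, a2, a3])\<rparr>"

fun simulates :: "('q::finite, 'c) program_config \<Rightarrow> 'c config \<Rightarrow> bool" where
  "simulates (q, h1, h2, h3) (n, ts) \<longleftrightarrow>
    n = code q \<and> (\<exists>t1 t2 t3. ts = [t1, t2, t3] \<and>
      represents h1 t1 \<and> represents h2 t2 \<and> represents h3 t3)"

lemma simulates_state: "simulates c d \<Longrightarrow> fst d = code (fst c)"
  by (cases c; cases d) auto

lemma code_eq_iff: "code x = code y \<longleftrightarrow> x = y"
  by (metis decode_code)

lemma simulates_step:
  assumes "simulates c d"
  shows "simulates (program_step \<delta> acc rej c) (step (machine_of \<delta> start acc rej extras) d)"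
proof -
  obtain q h1 h2 h3 where c: "c = (q, h1, h2, h3)"
    by (metis surj_pair)
  obtain t1 t2 t3 where d: "d = (code q, [t1, t2, t3])"
    and rep: "represents h1 t1" "represents h2 t2" "represents h3 t3"
    using assms by (cases d) (auto simp: c)
  show ?thesis
    using rep
    by (auto simp: c d machine_of_def code_eq_iff represents_read represents_act
        simp del: split_paired_Ex split: prod.split)
qed

lemma simulates_run:
  assumes "simulates c d"
  shows "simulates ((program_step \<delta> acc rej ^^ t) c)
    ((step (machine_of \<delta> start acc rej extras) ^^ t) d)"
  by (induction t) (simp_all add: assms simulates_step)

theorem in_class_P_by_program:
  fixes L :: "'c::finite list set" and \<delta> :: "('q::finite, 'c) program" and p :: "nat poly"
    and extras :: nat
  defines "alphabet \<equiv> {Blank} \<union> range Letter \<union> Extra ` {..<extras}"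
  assumes "acc \<noteq> rej"
    and closed: "\<And>q x y z q' a1 a2 a3. \<delta> q x y z = (q', a1, a2, a3) \<Longrightarrow>
      {x, y, z} \<subseteq> alphabet \<Longrightarrow> {fst a1, fst a2, fst a3} \<subseteq> alphabet"
    and decides: "\<And>w. \<exists>t \<le> poly p (length w).
      fst ((program_step \<delta> acc rej ^^ t) (start, ([], map Letter w), ([], []), ([], []))) =
        (if w \<in> L then acc else rej)"
  shows "L \<in> class_P"
proof -
  let ?M = "machine_of \<delta> start acc rej extras"
  have alphabet: "tape_alphabet ?M = alphabet"
    by (simp add: tape_alphabet_def machine_of_def alphabet_def)
  have closed_machine: "q' < card (UNIV :: 'q set) \<and> length acts = 3 \<and> fst ` set acts \<subseteq> alphabet"
    if valid: "length syms = 3" "set syms \<subseteq> alphabet" "transition ?M q syms = (q', acts)" for q syms q' acts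
  proof -
    obtain x y z where syms: "syms = [x, y, z]"
      using valid(1) by (auto simp: numeral_3_eq_3 length_Suc_conv)
    obtain r a1 a2 a3 where r: "\<delta> (decode q) x y z = (r, a1, a2, a3)"
      by (metis surj_pair)
    then have "q' = code r" "acts = [a1, a2, a3]"
      using valid(3) by (simp_all add: machine_of_def syms)
    then show ?thesis
      using closed[OF r] valid(2) syms code_less by auto
  qed
  have fields: "num_tapes ?M = 3" "num_states ?M = card (UNIV :: 'q set)"
    "start_state ?M = code start" "accept_state ?M = code acc" "reject_state ?M = code rej"
    by (simp_all add: machine_of_def)
  have "turing_machine ?M"
    unfolding turing_machine_def fields alphabet
    by (simp add: assms(2) code_less code_eq_iff) (use closed_machine in blast)
  moreover have "decides_in_time ?M L (poly p)"
    unfolding decides_in_time_def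
  proof
    fix w
    let ?c = "(start, ([], map Letter w), ([], []), ([], [])) :: ('q, 'c) program_config"
    obtain t where t: "t \<le> poly p (length w)"
      "fst ((program_step \<delta> acc rej ^^ t) ?c) = (if w \<in> L then acc else rej)"
      using decides by blast
    have "simulates ?c (initial_config ?M w)"
      by (auto simp: initial_config_def machine_of_def input_tape_def blank_tape_def
          numeral_2_eq_2 nat_add_distrib cell_at_def)
    from simulates_state[OF simulates_run[OF this, of t \<delta> acc rej start extras]]
    have "fst ((step ?M ^^ t) (initial_config ?M w)) = code (if w \<in> L then acc else rej)"
      using t(2) by simp
    then show "\<exists>t\<le>poly p (length w). fst ((step ?M ^^ t) (initial_config ?M w)) =
        (if w \<in> L then accept_state ?M else reject_state ?M)"
      using t(1) by (intro exI[of _ t]) (simp add: machine_of_def)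
  qed
  ultimately show ?thesis
    unfolding class_P_def by blast
qed


section \<open>A program for the membership problem\<close>

text \<open>\<open>Start\<close> copies the input to the third tape. \<open>Copy\<close> runs back over the target \<open>b\<close> and sets up
  the second tape; its argument says whether nothing has been copied yet, that is, whether \<open>b\<close>
  may still be empty. \<open>Rewind\<close> returns to the beginning of the input and starts a new round as
  long as the third tape is not used up. \<open>Forward\<close> and \<open>Back\<close> are the two passes over a
  generator; their arguments are the outcomes of the left and the right test. \<open>Verify\<close> checks
  \<open>l * r = b\<close>.\<close>

datatype phase = Start | Copy bool | Rewind | Forward bool bool | Back bool bool | Verify
  | Accept | Reject

instance phase :: finite
proof
  have "UNIV \<subseteq> {Start, Rewind, Verify, Accept, Reject} \<union> range Copy \<union>
      range (\<lambda>(l, r). Forward l r) \<union> range (\<lambda>(l, r). Back l r)"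
  proof
    fix p :: phase
    show "p \<in> {Start, Rewind, Verify, Accept, Reject} \<union> range Copy \<union>
      range (\<lambda>(l, r). Forward l r) \<union> range (\<lambda>(l, r). Back l r)"
      by (cases p) auto
  qed
  then show "finite (UNIV :: phase set)"
    by (rule finite_subset) simp
qed

text \<open>Coordinates of the target, of the left product, of the right product and of the tuple that was
  read last.\<close>

type_synonym 'a record_cell = "'a \<times> 'a option \<times> 'a option \<times> 'a"

abbreviation Cell :: "'a::finite record_cell \<Rightarrow> 'a option symbol" where
  "Cell x \<equiv> Extra (code x)"

fun load :: "'a record_cell \<Rightarrow> 'a \<Rightarrow> 'a record_cell" where
  "load (b, l, r, _) c = (b, l, r, c)"

fun left_test :: "'a::semigroup_mult record_cell \<Rightarrow> bool" where
  "left_test (b, l, r, c) \<longleftrightarrow> l * Some c * Some b = Some b"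

fun right_test :: "'a::semigroup_mult record_cell \<Rightarrow> bool" where
  "right_test (b, l, r, c) \<longleftrightarrow> Some b * (Some c * r) = Some b"

fun update :: "bool \<Rightarrow> bool \<Rightarrow> 'a::semigroup_mult record_cell \<Rightarrow> 'a record_cell" where
  "update fl fr (b, l, r, c) =
    (b, if fl then l * Some c else l, if fr then Some c * r else r, c)"

fun verified :: "'a::semigroup_mult record_cell \<Rightarrow> bool" where
  "verified (b, l, r, c) \<longleftrightarrow> l * r = Some b"

text \<open>A round also runs over the target at the end of the input, but with both tests counted as failed,
  so that it is not used as a generator. The end of a block and the end of the second tape have to
  coincide; otherwise the input is not an instance and is rejected.\<close>

fun program :: "(phase, 'a::{finite, semigroup_mult} option) program" where
  "program Start x y z =
    (case x of
      Letter c \<Rightarrow> (Start, (x, MoveRight), (y, Stay), (x, MoveRight))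
    | _ \<Rightarrow> (Copy True, (x, MoveLeft), (y, Stay), (z, MoveLeft)))"
| "program (Copy first_cell) x y z =
    (case x of
      Letter (Some c) \<Rightarrow>
        (Copy False, (x, MoveLeft), (Cell (c, None, None, c), MoveLeft), (z, Stay))
    | _ \<Rightarrow> (if first_cell then Reject else Rewind, (x, Stay), (y, Stay), (z, Stay)))"
| "program Rewind x y z =
    (case x of
      Letter c \<Rightarrow> (Rewind, (x, MoveLeft), (y, Stay), (z, Stay))
    | _ \<Rightarrow> if z = Blank then (Verify, (x, MoveRight), (y, MoveRight), (z, Stay))
        else (Forward True True, (x, MoveRight), (y, MoveRight), (z, MoveLeft)))"
| "program (Forward fl fr) x y z =
    (case (x, y) of
      (Letter (Some c), Extra i) \<Rightarrow>
        let cell = load (decode i) c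
        in (Forward (fl \<and> left_test cell) (fr \<and> right_test cell),
          (x, MoveRight), (Cell cell, MoveRight), (z, Stay))
    | (Letter None, Blank) \<Rightarrow> (Back fl fr, (x, Stay), (y, MoveLeft), (z, Stay))
    | (Blank, Blank) \<Rightarrow> (Back False False, (x, Stay), (y, MoveLeft), (z, Stay))
    | _ \<Rightarrow> (Reject, (x, Stay), (y, Stay), (z, Stay)))"
| "program (Back fl fr) x y z =
    (case y of
      Extra i \<Rightarrow>
        (Back fl fr, (x, Stay), (Cell (update fl fr (decode i)), MoveLeft), (z, Stay))
    | _ \<Rightarrow> if x = Blank then (Rewind, (x, MoveLeft), (y, Stay), (z, Stay))
        else (Forward True True, (x, MoveRight), (y, MoveRight), (z, Stay)))"
| "program Verify x y z =
    (case y of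
      Extra i \<Rightarrow>
        (if verified (decode i :: 'a record_cell) then Verify else Reject,
          (x, Stay), (y, MoveRight), (z, Stay))
    | _ \<Rightarrow> (Accept, (x, Stay), (y, Stay), (z, Stay)))"
| "program Accept x y z = (Accept, (x, Stay), (y, Stay), (z, Stay))"
| "program Reject x y z = (Reject, (x, Stay), (y, Stay), (z, Stay))"

lemma program_alphabet:
  fixes x y z :: "'a::{finite, semigroup_mult} option symbol"
  defines "alphabet \<equiv>
    {Blank} \<union> range Letter \<union> Extra ` {..<card (UNIV :: 'a record_cell set)}"
  assumes "program q x y z = (q', a1, a2, a3)" "{x, y, z} \<subseteq> alphabet"
  shows "{fst a1, fst a2, fst a3} \<subseteq> alphabet"
proof -
  have cell: "Cell c \<in> alphabet" for c :: "'a record_cell"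
    using code_less[of c] by (simp add: alphabet_def)
  show ?thesis
    using assms(2,3)
    by (cases q) (auto simp: Let_def intro!: cell split: symbol.splits option.splits if_splits)
qed

type_synonym 'a program_conf = "(phase, 'a option) program_config"

abbreviation next_conf ::
    "'a::{finite, semigroup_mult} program_conf \<Rightarrow> 'a program_conf" where
  "next_conf \<equiv> program_step program Accept Reject"

definition reaches ::
    "nat \<Rightarrow> 'a::{finite, semigroup_mult} program_conf \<Rightarrow> 'a program_conf \<Rightarrow> bool" where
  "reaches T c d \<longleftrightarrow> (\<exists>t\<le>T. (next_conf ^^ t) c = d)"

definition halts ::
    "nat \<Rightarrow> 'a::{finite, semigroup_mult} program_conf \<Rightarrow> phase \<Rightarrow> bool" where
  "halts T c q \<longleftrightarrow> (\<exists>t\<le>T. fst ((next_conf ^^ t) c) = q)"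

lemma reaches_refl: "reaches T c c"
  unfolding reaches_def by (rule exI[of _ 0]) simp

lemma reaches_trans: "reaches T c d \<Longrightarrow> reaches T' d e \<Longrightarrow> T + T' \<le> T'' \<Longrightarrow> reaches T'' c e"
proof -
  assume "reaches T c d" "reaches T' d e" "T + T' \<le> T''"
  then obtain t t' where "t \<le> T" "t' \<le> T'" "(next_conf ^^ t) c = d" "(next_conf ^^ t') d = e"
    unfolding reaches_def by blast
  then show "reaches T'' c e"
    using \<open>T + T' \<le> T''\<close> unfolding reaches_def
    by (intro exI[of _ "t' + t"]) (simp add: funpow_add)
qed

lemma reaches_add [trans]: "reaches T c d \<Longrightarrow> reaches T' d e \<Longrightarrow> reaches (T + T') c e"
  by (erule reaches_trans, assumption) (rule order_refl)

lemma reaches_mono: "reaches T c d \<Longrightarrow> T \<le> T' \<Longrightarrow> reaches T' c d"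
  using reaches_trans[OF reaches_refl[of 0]] by simp

lemma halts_trans: "reaches T c d \<Longrightarrow> halts T' d q \<Longrightarrow> T + T' \<le> T'' \<Longrightarrow> halts T'' c q"
proof -
  assume "reaches T c d" "halts T' d q" "T + T' \<le> T''"
  then obtain t t' where "t \<le> T" "t' \<le> T'" "(next_conf ^^ t) c = d" "fst ((next_conf ^^ t') d) = q"
    unfolding reaches_def halts_def by blast
  then show "halts T'' c q"
    using \<open>T + T' \<le> T''\<close> unfolding halts_def
    by (intro exI[of _ "t' + t"]) (simp add: funpow_add)
qed

lemma reaches_step: "reaches T (next_conf c) d \<Longrightarrow> reaches (Suc T) c d"
  by (rule reaches_trans[of 1 c "next_conf c" T]) (auto simp: reaches_def intro: exI[of _ 1])

text \<open>Equations as premises let the simplifier compute one step of the program and compare the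
  configurations.\<close>

lemma reaches_after_step:
  "next_conf c = c' \<Longrightarrow> reaches T c' d' \<Longrightarrow> T' = Suc T \<Longrightarrow> d' = d \<Longrightarrow> reaches T' c d"
  using reaches_step by blast

lemma halts_step: "halts T (next_conf c) q \<Longrightarrow> halts (Suc T) c q"
  by (rule halts_trans[of 1 c "next_conf c" T]) (auto simp: reaches_def intro: exI[of _ 1])

lemma halts_after_step:
  "next_conf c = c' \<Longrightarrow> halts T c' q \<Longrightarrow> T' = Suc T \<Longrightarrow> halts T' c q"
  using halts_step by blast

lemma halts_now: "fst c = q \<Longrightarrow> halts T c q"
  unfolding halts_def by (rule exI[of _ 0]) simp

lemma push_simps [simp]:
  "push (Letter c) xs = Letter c # xs"
  "push (Extra i) xs = Extra i # xs"
  "push Blank [] = []"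
  "first (push s xs) = s"
  "tl (push s xs) = xs"
  by (auto simp: push_def)

text \<open>Rewriting the symbol under a resting head is harmless for configurations of the form
  \<open>move_left h\<close>, because \<open>push\<close> has brought their right half into normal form. Tapes that rest
  during a phase are therefore given in this form.\<close>

lemma act_stay [simp]:
  "act_halves (read_halves (move_left h), Stay) (move_left h) = move_left h"
  by (cases h) simp

abbreviation letters :: "'c list \<Rightarrow> 'c symbol list" where
  "letters \<equiv> map Letter"

abbreviation block :: "'a list \<Rightarrow> 'a option symbol list" where
  "block a \<equiv> map (\<lambda>s. Letter (Some s)) a"

text \<open>In the following lemmas the numbers of steps are upper bounds, and the halves of the tapes outside
  of the part that is run over are arbitrary, as the inductions need.\<close>

lemma start_run:
  "reaches (Suc (length w)) (Start, (ls, letters w), ([], []), (ls', []))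
    (Copy True, move_left (rev (letters w) @ ls, []), ([], []), move_left (rev (letters w) @ ls', []))"
proof (induction w arbitrary: ls ls')
  case Nil
  show ?case
    by (rule reaches_step) (simp add: reaches_refl)
next
  case (Cons c w)
  show ?case
    by (rule reaches_after_step[OF _ Cons.IH[of "Letter c # ls" "Letter c # ls'"]])
      (simp_all)
qed

lemma copy_run:
  "reaches (length c)
    (Copy first_cell, move_left (block c @ ls, rs), move_left ([], map Cell xs), move_left h3)
    (Copy (first_cell \<and> c = []), move_left (ls, rev (block c) @ rs),
      move_left ([], map Cell (rev (map (\<lambda>s. (s, None, None, s)) c) @ xs)), move_left h3)"
proof (induction c arbitrary: first_cell rs xs)
  case Nil
  show ?case
    by (simp add: reaches_refl)
next
  case (Cons s c)
  show ?case
    by (rule reaches_after_step[OF _ Cons.IH[of False "Letter (Some s) # rs" "(s, None, None, s) # xs"]])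
      (simp_all)
qed

lemma rewind_run:
  "reaches (length c)
    (Rewind, move_left (letters c, rs), move_left h2, move_left h3)
    (Rewind, move_left ([], rev (letters c) @ rs), move_left h2, move_left h3)"
proof (induction c arbitrary: rs)
  case Nil
  show ?case
    by (simp add: reaches_refl)
next
  case (Cons s c)
  show ?case
    by (rule reaches_after_step[OF _ Cons.IH[of "Letter s # rs"]])
      (simp_all)
qed

lemma forward_run:
  assumes "length a = length xs"
  shows "reaches (length a)
    (Forward fl fr, (ls, block a @ rs), (ls', map Cell xs), move_left h3)
    (Forward (fl \<and> (\<forall>x\<in>set (map2 load xs a). left_test x))
        (fr \<and> (\<forall>x\<in>set (map2 load xs a). right_test x)),
      (rev (block a) @ ls, rs), (rev (map Cell (map2 load xs a)) @ ls', []), move_left h3)"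
  using assms
proof (induction a xs arbitrary: fl fr ls ls' rule: list_induct2)
  case Nil
  show ?case
    by (simp add: reaches_refl)
next
  case (Cons s a x xs)
  show ?case
    by (rule reaches_after_step[OF _ Cons.IH[of "fl \<and> left_test (load x s)" "fr \<and> right_test (load x s)"
        "Letter (Some s) # ls" "Cell (load x s) # ls'"]])
      (simp_all add: Let_def conj_assoc)
qed

text \<open>If a block does not have the length of the target, then one of the two tapes ends earlier than the
  other.\<close>

lemma forward_reject:
  assumes "length a \<noteq> length xs" and "first rs \<in> {Blank, Letter None}"
  shows "halts (Suc (length a))
    (Forward fl fr, (ls, block a @ rs), (ls', map Cell xs), move_left h3) Reject"
  using assms(1)
proof (induction a xs arbitrary: fl fr ls ls' rule: list_induct2')
  case (2 s a)
  show ?case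
    by (rule halts_step, rule halts_now) simp
next
  case (3 x xs)
  show ?case
    by (rule halts_step, rule halts_now) (use assms(2) in auto)
next
  case (4 s a x xs)
  then have "length a \<noteq> length xs"
    by simp
  then show ?case
    by (intro halts_after_step[OF _ "4.IH"]) (simp_all add: Let_def)
qed simp

lemma back_run:
  assumes "push (first rs) (tl rs) = rs"
  shows "reaches (length xs)
    (Back fl fr, (ls, rs), move_left (map Cell xs, rs'), move_left h3)
    (Back fl fr, (ls, rs), move_left ([], rev (map Cell (map (update fl fr) xs)) @ rs'),
      move_left h3)"
proof (induction xs arbitrary: rs')
  case Nil
  show ?case
    by (simp add: reaches_refl)
next
  case (Cons x xs)
  show ?case
    by (rule reaches_after_step[OF _ Cons.IH[of "Cell (update fl fr x) # rs'"]])
      (simp_all add: assms)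
qed


section \<open>Correctness and running time of the program\<close>

definition process :: "'a::semigroup_mult record_cell list \<Rightarrow> 'a list \<Rightarrow> 'a record_cell list" where
  "process xs a = (let ys = map2 load xs a in
    map (update (\<forall>y\<in>set ys. left_test y) (\<forall>y\<in>set ys. right_test y)) ys)"

lemma update_False [simp]: "update False False = id"
  by (simp add: fun_eq_iff)

lemma length_process [simp]: "length (process xs a) = min (length xs) (length a)"
  by (simp add: process_def Let_def)

text \<open>The second tape begins and ends with its head on the leftmost cell, ready for the next block.\<close>

lemma block_run:
  assumes "length a = length xs"
  shows "reaches (2 * length a + 2)
    (Forward True True, (ls, block a @ Letter None # rs), ([], map Cell xs), move_left h3)
    (Forward True True, (Letter None # rev (block a) @ ls, rs), ([], map Cell (process xs a)),
      move_left h3)"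
proof -
  define ys where "ys = map2 load xs a"
  define fl fr where "fl = (\<forall>y\<in>set ys. left_test y)" and "fr = (\<forall>y\<in>set ys. right_test y)"
  let ?h1 = "(rev (block a) @ ls, Letter None # rs)"
  have "reaches (length a)
    (Forward True True, (ls, block a @ Letter None # rs), ([], map Cell xs), move_left h3)
    (Forward fl fr, ?h1, (map Cell (rev ys), []), move_left h3)"
    using forward_run[OF assms, of True True ls "Letter None # rs" "[]" h3]
    by (simp add: ys_def fl_def fr_def rev_map)
  also have "reaches 1 (Forward fl fr, ?h1, (map Cell (rev ys), []), move_left h3)
    (Back fl fr, ?h1, move_left (map Cell (rev ys), []), move_left h3)"
    by (rule reaches_after_step[OF _ reaches_refl[of 0]]) simp_all
  also have "reaches (length a)
    (Back fl fr, ?h1, move_left (map Cell (rev ys), []), move_left h3)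
    (Back fl fr, ?h1, move_left ([], map Cell (map (update fl fr) ys)), move_left h3)"
    using back_run[of "Letter None # rs" "rev ys" fl fr "rev (block a) @ ls" "[]" h3] assms
    by (simp add: ys_def rev_map)
  also have "reaches 1
    (Back fl fr, ?h1, move_left ([], map Cell (map (update fl fr) ys)), move_left h3)
    (Forward True True, (Letter None # rev (block a) @ ls, rs),
      ([], map Cell (map (update fl fr) ys)), move_left h3)"
    by (rule reaches_after_step[OF _ reaches_refl[of 0]]) simp_all
  finally show ?thesis
    unfolding process_def Let_def ys_def[symmetric] fl_def[symmetric] fr_def[symmetric]
    by (rule reaches_mono) simp
qed

lemma last_block_run:
  assumes "length a = length xs"
  shows "reaches (2 * length a + 2)
    (Forward True True, (ls, block a), ([], map Cell xs), move_left h3)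
    (Rewind, move_left (rev (block a) @ ls, []), move_left ([], map Cell (map2 load xs a)),
      move_left h3)"
proof -
  define ys where "ys = map2 load xs a"
  define fl fr where "fl = (\<forall>y\<in>set ys. left_test y)" and "fr = (\<forall>y\<in>set ys. right_test y)"
  let ?h1 = "(rev (block a) @ ls, [])"
  have "reaches (length a)
    (Forward True True, (ls, block a), ([], map Cell xs), move_left h3)
    (Forward fl fr, ?h1, (map Cell (rev ys), []), move_left h3)"
    using forward_run[OF assms, of True True ls "[]" "[]" h3]
    by (simp add: ys_def fl_def fr_def rev_map)
  also have "reaches 1 (Forward fl fr, ?h1, (map Cell (rev ys), []), move_left h3)
    (Back False False, ?h1, move_left (map Cell (rev ys), []), move_left h3)"
    by (rule reaches_after_step[OF _ reaches_refl[of 0]]) simp_all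
  also have "reaches (length a)
    (Back False False, ?h1, move_left (map Cell (rev ys), []), move_left h3)
    (Back False False, ?h1, move_left ([], map Cell ys), move_left h3)"
    using back_run[of "[]" "rev ys" False False "rev (block a) @ ls" "[]" h3] assms
    by (simp add: ys_def rev_map)
  also have "reaches 1
    (Back False False, ?h1, move_left ([], map Cell ys), move_left h3)
    (Rewind, move_left ?h1, move_left ([], map Cell ys), move_left h3)"
    by (rule reaches_after_step[OF _ reaches_refl[of 0]]) simp_all
  finally show ?thesis
    unfolding ys_def[symmetric]
    by (rule reaches_mono) simp
qed

lemma encode_instance_simps:
  "encode_instance [] b = map Some b"
  "encode_instance (a # as) b = map Some a @ None # encode_instance as b"
  by (simp_all add: encode_instance_def)

lemma round_run:
  assumes "\<forall>a\<in>set as. length a = length xs" "length b = length xs"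
  shows "reaches (2 * length (encode_instance as b) + 2)
    (Forward True True, (ls, letters (encode_instance as b)), ([], map Cell xs), move_left h3)
    (Rewind, move_left (rev (letters (encode_instance as b)) @ ls, []),
      move_left ([], map Cell (map2 load (foldl process xs as) b)), move_left h3)"
  using assms
proof (induction as arbitrary: ls xs)
  case Nil
  then show ?case
    using last_block_run[of b xs ls h3] by (simp add: encode_instance_simps comp_def)
next
  case (Cons a as)
  let ?w = "encode_instance as b"
  have "reaches (2 * length a + 2)
    (Forward True True, (ls, letters (encode_instance (a # as) b)), ([], map Cell xs), move_left h3)
    (Forward True True, (Letter None # rev (block a) @ ls, letters ?w),
      ([], map Cell (process xs a)), move_left h3)"
    using block_run[of a xs ls "letters ?w" h3] Cons.prems
    by (simp add: encode_instance_simps comp_def)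
  moreover have "reaches (2 * length ?w + 2)
    (Forward True True, (Letter None # rev (block a) @ ls, letters ?w),
      ([], map Cell (process xs a)), move_left h3)
    (Rewind, move_left (rev (letters ?w) @ Letter None # rev (block a) @ ls, []),
      move_left ([], map Cell (map2 load (foldl process (process xs a) as) b)), move_left h3)"
    using Cons.prems by (intro Cons.IH) auto
  ultimately have "reaches (2 * length (encode_instance (a # as) b) + 2)
    (Forward True True, (ls, letters (encode_instance (a # as) b)), ([], map Cell xs), move_left h3)
    (Rewind, move_left (rev (letters ?w) @ Letter None # rev (block a) @ ls, []),
      move_left ([], map Cell (map2 load (foldl process (process xs a) as) b)), move_left h3)"
    by (rule reaches_trans) (simp add: encode_instance_simps)
  then show ?case
    by (simp add: encode_instance_simps comp_def rev_map)
qed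

lemma round_reject:
  assumes "\<not> (\<forall>a\<in>set as. length a = length xs)"
  shows "halts (2 * length (encode_instance as b) + 2)
    (Forward True True, (ls, letters (encode_instance as b)), ([], map Cell xs), move_left h3)
    Reject"
  using assms
proof (induction as arbitrary: ls xs)
  case Nil
  then show ?case by simp
next
  case (Cons a as)
  let ?w = "encode_instance as b"
  have w: "letters (encode_instance (a # as) b) = block a @ Letter None # letters ?w"
    by (simp add: encode_instance_simps comp_def)
  show ?case
  proof (cases "length a = length xs")
    case True
    have "reaches (2 * length a + 2)
      (Forward True True, (ls, letters (encode_instance (a # as) b)), ([], map Cell xs), move_left h3)
      (Forward True True, (Letter None # rev (block a) @ ls, letters ?w),
        ([], map Cell (process xs a)), move_left h3)"
      unfolding w using block_run[OF True] .
    moreover have "halts (2 * length ?w + 2)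
      (Forward True True, (Letter None # rev (block a) @ ls, letters ?w),
        ([], map Cell (process xs a)), move_left h3) Reject"
      using Cons.prems True by (intro Cons.IH) auto
    ultimately show ?thesis
      by (rule halts_trans) (simp add: encode_instance_simps)
  next
    case False
    have "halts (Suc (length a)) (Forward True True, (ls, letters (encode_instance (a # as) b)),
      ([], map Cell xs), move_left h3) Reject"
      unfolding w using forward_reject[OF False, of "Letter None # letters ?w"] by simp
    then show ?thesis
      by (rule halts_trans[OF reaches_refl[of 0]]) (simp add: encode_instance_simps)
  qed
qed

text \<open>The contents of the second tape, with \<open>u\<close> the word of the left product and \<open>v\<close> the reversed
  word of the right product. The last component is a leftover of the tuple read last; it is
  overwritten before it is used.\<close>

definition records :: "'a::semigroup_mult list \<Rightarrow> 'a list list \<Rightarrow> 'a list list \<Rightarrow> 'a list \<Rightarrow>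
    'a record_cell list" where
  "records b u v c =
    map (\<lambda>j. (b ! j, coord_prod j u, coord_prod j (rev v), c ! j)) [0..<length b]"

lemma length_records [simp]: "length (records b u v c) = length b"
  by (simp add: records_def)

lemma load_records: "length a = length b \<Longrightarrow> map2 load (records b u v c) a = records b u v a"
  by (rule nth_equalityI) (simp_all add: records_def)

lemma process_records:
  assumes "length a = length b"
  shows "process (records b u v c) a =
    records b (try_append (left_stable b) u a) (try_append (right_stable b) v a) a"
proof -
  have "(\<forall>y\<in>set (records b u v a). left_test y) \<longleftrightarrow> left_stable b (u @ [a])"
    "(\<forall>y\<in>set (records b u v a). right_test y) \<longleftrightarrow> right_stable b (v @ [a])"
    by (auto simp: records_def left_stable_def right_stable_def)
  then show ?thesis
    by (simp add: process_def load_records[OF assms]) (simp add: records_def try_append_def)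
qed

lemma foldl_process_records:
  assumes "\<forall>a\<in>set as. length a = length b"
  shows "\<exists>c'. foldl process (records b u v c) as =
    records b (foldl (try_append (left_stable b)) u as) (foldl (try_append (right_stable b)) v as) c'"
  using assms by (induction as arbitrary: u v c) (auto simp: process_records)

text \<open>The list \<open>l\<close> is the rest of the third tape that has not been used up, so its length is the number
  of rounds to come. Reading the target at the end of a round makes the last component of the
  records equal to \<open>b\<close> again.\<close>

lemma loop_run:
  fixes as :: "'a::{finite, semigroup_mult} list list"
  assumes "\<forall>a\<in>set as. length a = length b"
  defines "w \<equiv> encode_instance as b"
  shows "reaches (length l * (3 * length w + 3) + 1)
    (Rewind, move_left ([], letters w), move_left ([], map Cell (records b u v b)),
      move_left (letters l, r))
    (Verify, ([], letters w),
      ([], map Cell (records b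
        (((\<lambda>u. foldl (try_append (left_stable b)) u as) ^^ length l) u)
        (((\<lambda>v. foldl (try_append (right_stable b)) v as) ^^ length l) v) b)),
      move_left ([], rev (letters l) @ r))"
proof (induction l arbitrary: u v r)
  case Nil
  show ?case
    by (rule reaches_after_step[OF _ reaches_refl[of 0]]) simp_all
next
  case (Cons s l)
  let ?u = "foldl (try_append (left_stable b)) u as" and ?v = "foldl (try_append (right_stable b)) v as"
  obtain c' where "foldl process (records b u v b) as = records b ?u ?v c'"
    using foldl_process_records[OF assms(1)] by blast
  then have cells: "map2 load (foldl process (records b u v b) as) b = records b ?u ?v b"
    by (simp add: load_records)
  have lengths: "\<forall>a\<in>set as. length a = length (records b u v b)"
    "length b = length (records b u v b)"
    using assms(1) by simp_all
  let ?h3 = "(letters l, Letter s # r)"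
  have "reaches 1
    (Rewind, move_left ([], letters w), move_left ([], map Cell (records b u v b)),
      move_left (letters (s # l), r))
    (Forward True True, ([], letters w), ([], map Cell (records b u v b)), move_left ?h3)"
    by (rule reaches_after_step[OF _ reaches_refl[of 0]]) simp_all
  also have "reaches (2 * length w + 2)
    (Forward True True, ([], letters w), ([], map Cell (records b u v b)), move_left ?h3)
    (Rewind, move_left (letters (rev w), []), move_left ([], map Cell (records b ?u ?v b)),
      move_left ?h3)"
    using round_run[OF lengths, of "[]" ?h3] by (simp only: cells w_def rev_map append_Nil2)
  also have "reaches (length w)
    (Rewind, move_left (letters (rev w), []), move_left ([], map Cell (records b ?u ?v b)),
      move_left ?h3)
    (Rewind, move_left ([], letters w), move_left ([], map Cell (records b ?u ?v b)),
      move_left ?h3)"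
    using rewind_run[of "rev w" "[]" "([], map Cell (records b ?u ?v b))" ?h3]
    by (simp only: rev_map rev_rev_ident append_Nil2 length_rev)
  also have "reaches (length l * (3 * length w + 3) + 1)
    (Rewind, move_left ([], letters w), move_left ([], map Cell (records b ?u ?v b)),
      move_left ?h3)
    (Verify, ([], letters w),
      ([], map Cell (records b
        (((\<lambda>u. foldl (try_append (left_stable b)) u as) ^^ length l) ?u)
        (((\<lambda>v. foldl (try_append (right_stable b)) v as) ^^ length l) ?v) b)),
      move_left ([], rev (letters l) @ Letter s # r))"
    by (rule Cons.IH)
  finally have "reaches (length (s # l) * (3 * length w + 3) + 1)
    (Rewind, move_left ([], letters w), move_left ([], map Cell (records b u v b)),
      move_left (letters (s # l), r))
    (Verify, ([], letters w),
      ([], map Cell (records b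
        (((\<lambda>u. foldl (try_append (left_stable b)) u as) ^^ length l) ?u)
        (((\<lambda>v. foldl (try_append (right_stable b)) v as) ^^ length l) ?v) b)),
      move_left ([], rev (letters l) @ Letter s # r))"
    by (rule reaches_mono) simp
  then show ?case
    by (simp add: funpow_Suc_right del: funpow.simps)
qed

lemma verify_run:
  assumes "push (first rs) (tl rs) = rs"
  shows "halts (Suc (length xs)) (Verify, (ls, rs), (ls', map Cell xs), move_left h3)
    (if \<forall>x\<in>set xs. verified x then Accept else Reject)"
proof (induction xs arbitrary: ls')
  case Nil
  show ?case
    by (rule halts_step, rule halts_now) simp
next
  case (Cons x xs)
  show ?case
  proof (cases "verified x")
    case True
    then have "(\<forall>y\<in>set (x # xs). verified y) \<longleftrightarrow> (\<forall>y\<in>set xs. verified y)"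
      by simp
    then show ?thesis
      using True by (simp only:, intro halts_after_step[OF _ Cons.IH[of "Cell x # ls'"]])
        (simp_all add: assms)
  next
    case False
    then show ?thesis
      by (intro halts_step halts_now) simp
  qed
qed

text \<open>Every string is the encoding of some list of blocks, so that an input can fail to be an instance
  only by the lengths of its blocks.\<close>

lemma encode_instance_exhaust: "\<exists>as b. w = encode_instance as b"
proof (induction w)
  case Nil
  show ?case
    by (intro exI[of _ "[]"]) (simp add: encode_instance_def)
next
  case (Cons c w)
  then obtain as b where w: "w = encode_instance as b"
    by blast
  show ?case
  proof (cases c)
    case None
    then show ?thesis
      by (intro exI[of _ "[] # as"] exI[of _ b]) (simp add: w encode_instance_simps)
  next
    case (Some s)
    show ?thesis
    proof (cases as)
      case Nil
      then show ?thesis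
        by (intro exI[of _ "[]"] exI[of _ "s # b"]) (simp add: w Some encode_instance_simps)
    next
      case (Cons a as')
      then show ?thesis
        by (intro exI[of _ "(s # a) # as'"] exI[of _ b]) (simp add: w Some encode_instance_simps)
    qed
  qed
qed

lemma encode_instance_in_SMP_iff:
  "encode_instance as b \<in> SMP \<longleftrightarrow> b \<noteq> [] \<and> (\<forall>a\<in>set as. length a = length b) \<and>
    b \<in> subsemigroup_generated tuple_mult (set as)"
  by (auto simp: SMP_def encode_instance_inject)

text \<open>What the first head sees once it has run back over the target.\<close>

lemma first_rev_generators:
  "first (rev (letters (concat (map (\<lambda>a. map Some a @ [None]) as)))) \<in> {Blank, Letter None}"
  by (cases as rule: rev_cases) auto

lemma length_encode_instance: "length as + length b \<le> length (encode_instance as b)"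
  by (induction as) (auto simp: encode_instance_simps)

lemma records_initial: "records b [] [] b = map (\<lambda>s. (s, None, None, s)) b"
  by (rule nth_equalityI) (simp_all add: records_def one_option_def)

lemma initial_run:
  fixes as :: "'a::{finite, semigroup_mult} list list" and b :: "'a list"
  defines "w \<equiv> encode_instance as b"
  shows "reaches (2 * length w + 1)
    (Start, ([], letters w), ([], []), ([], []))
    (Copy (b = []), move_left (rev (letters (concat (map (\<lambda>a. map Some a @ [None]) as))), block b),
      move_left ([], map Cell (records b [] [] b)), move_left (letters (rev w), []))"
proof -
  let ?u = "concat (map (\<lambda>a. map Some a @ [None]) as)"
  have rev_w: "rev (letters w) = block (rev b) @ rev (letters ?u)"
    "letters (rev w) = block (rev b) @ rev (letters ?u)"
    by (simp_all add: w_def encode_instance_def rev_map)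
  have empty_tape: "move_left ([], map Cell []) = ([], [])"
    by simp
  have "reaches (Suc (length w)) (Start, ([], letters w), ([], []), ([], []))
    (Copy True, move_left (block (rev b) @ rev (letters ?u), []), move_left ([], map Cell []),
      move_left (letters (rev w), []))"
    using start_run[of w "[]" "[]"] by (simp only: rev_w empty_tape append_Nil2)
  also have "reaches (length b)
    (Copy True, move_left (block (rev b) @ rev (letters ?u), []), move_left ([], map Cell []),
      move_left (letters (rev w), []))
    (Copy (b = []), move_left (rev (letters ?u), block b),
      move_left ([], map Cell (records b [] [] b)), move_left (letters (rev w), []))"
    using copy_run[of "rev b" True "rev (letters ?u)" "[]" "[]" "(letters (rev w), [])"]
    by (simp add: records_initial rev_map)
  finally show ?thesis
    by (rule reaches_mono) (use length_encode_instance[of as b] in \<open>simp add: w_def\<close>)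
qed

text \<open>The input has more symbols than there are generators, so the copy on the third tape provides
  enough rounds. They dominate the running time: at most \<open>3 * length w + 3\<close> steps each.\<close>

lemma program_decides:
  fixes w :: "'a::{finite, semigroup_mult} option list"
  assumes "regular_band TYPE('a)"
  shows "halts (poly [:5, 7, 3:] (length w)) (Start, ([], letters w), ([], []), ([], []))
    (if w \<in> SMP then Accept else Reject)"
proof -
  obtain as b where w: "w = encode_instance as b"
    using encode_instance_exhaust by blast
  define u where "u = concat (map (\<lambda>a. map Some a @ [None]) as)"
  have w_split: "w = u @ map Some b"
    by (simp add: w u_def encode_instance_def)
  have N: "length as + length b \<le> length w"
    using length_encode_instance by (simp add: w)
  have u: "first (rev (letters u)) \<in> {Blank, Letter None}"
    unfolding u_def by (rule first_rev_generators)
  let ?h2 = "([], map Cell (records b [] [] b))" and ?h3 = "(letters (rev w), [])"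
  have initial: "reaches (2 * length w + 1) (Start, ([], letters w), ([], []), ([], []))
    (Copy (b = []), move_left (rev (letters u), block b), move_left ?h2, move_left ?h3)"
    using initial_run[of as b] unfolding u_def w .
  show ?thesis
  proof (cases "b = []")
    case True
    have "halts 1 (Copy (b = []), move_left (rev (letters u), block b), move_left ?h2, move_left ?h3)
      Reject"
      unfolding One_nat_def by (rule halts_step, rule halts_now) (use u True in auto)
    then have "halts (poly [:5, 7, 3:] (length w)) (Start, ([], letters w), ([], []), ([], []))
      Reject"
      by (rule halts_trans[OF initial]) (simp add: algebra_simps)
    moreover have "w \<notin> SMP"
      using True unfolding w encode_instance_in_SMP_iff by blast
    ultimately show ?thesis
      by simp
  next
    case False
    note initial
    also have "reaches 1
      (Copy (b = []), move_left (rev (letters u), block b), move_left ?h2, move_left ?h3)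
      (Rewind, move_left (letters (rev u), block b), move_left ?h2, move_left ?h3)"
      by (rule reaches_after_step[OF _ reaches_refl[of 0]]) (use u False in \<open>auto simp: rev_map\<close>)
    also have "reaches (length u)
      (Rewind, move_left (letters (rev u), block b), move_left ?h2, move_left ?h3)
      (Rewind, move_left ([], letters w), move_left ?h2, move_left ?h3)"
      using rewind_run[of "rev u" "block b" ?h2 ?h3]
      by (simp only: w_split rev_map[symmetric] rev_rev_ident length_rev map_append map_map comp_def)
    finally have rewound: "reaches (3 * length w + 2) (Start, ([], letters w), ([], []), ([], []))
      (Rewind, move_left ([], letters w), move_left ?h2, move_left ?h3)"
      by (rule reaches_mono) (simp add: w_split)
    show ?thesis
    proof (cases "\<forall>a\<in>set as. length a = length b")
      case True
      let ?l = "greedy_left as b (length w)" and ?r = "greedy_right as b (length w)"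
      have few: "length as < length w"
        using N False by (cases b) simp_all
      have letters_w: "push (first (letters w)) (tl (letters w)) = letters w"
        by (cases w) simp_all
      let ?end = "(Verify, ([], letters w), ([], map Cell (records b ?l ?r b)),
        move_left ([], letters w))"
      note rewound
      also have "reaches (length w * (3 * length w + 3) + 1)
        (Rewind, move_left ([], letters w), move_left ?h2, move_left ?h3) ?end"
        using loop_run[OF True, of "rev w" "[]" "[]" "[]"]
        by (simp only: w[symmetric] greedy_left_def greedy_right_def greedy_word_def length_rev
            rev_map rev_rev_ident append_Nil2)
      finally have run: "reaches (3 * length w + 2 + (length w * (3 * length w + 3) + 1))
        (Start, ([], letters w), ([], []), ([], [])) ?end" .
      have "(\<forall>x\<in>set (records b ?l ?r b). verified x) \<longleftrightarrow> w \<in> SMP"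
        using generated_iff_greedy[OF assms False True few] False True
        by (auto simp: w encode_instance_in_SMP_iff records_def)
      moreover have "halts (Suc (length b)) ?end
        (if \<forall>x\<in>set (records b ?l ?r b). verified x then Accept else Reject)"
        using verify_run[of "letters w" "records b ?l ?r b" "[]" "[]" "([], letters w)"]
        by (simp only: letters_w length_records)
      ultimately have "halts (Suc (length b)) ?end (if w \<in> SMP then Accept else Reject)"
        by simp
      then show ?thesis
        by (rule halts_trans[OF run]) (use N in \<open>simp add: algebra_simps\<close>)
    next
      case bad: False
      have "w \<noteq> []"
        using False w_split by simp
      then obtain c w' where "w = w' @ [c]"
        by (metis rev_exhaust)
      then have top: "letters (rev w) = Letter c # letters (rev w')"
        by simp
      let ?h3' = "(letters (rev w'), [Letter c])"
      note rewound
      also have "reaches 1 (Rewind, move_left ([], letters w), move_left ?h2, move_left ?h3)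
        (Forward True True, ([], letters w), ?h2, move_left ?h3')"
        unfolding top by (rule reaches_after_step[OF _ reaches_refl[of 0]]) simp_all
      finally have run: "reaches (3 * length w + 2 + 1) (Start, ([], letters w), ([], []), ([], []))
        (Forward True True, ([], letters w), ?h2, move_left ?h3')" .
      have "halts (2 * length w + 2) (Forward True True, ([], letters w), ?h2, move_left ?h3') Reject"
        unfolding w by (rule round_reject) (use bad in simp)
      then have "halts (poly [:5, 7, 3:] (length w)) (Start, ([], letters w), ([], []), ([], []))
        Reject"
        by (rule halts_trans[OF run]) (simp add: algebra_simps)
      moreover have "w \<notin> SMP"
        using bad unfolding w encode_instance_in_SMP_iff by blast
      ultimately show ?thesis
        by simp
    qed
  qed
qed

theorem corollary1p7:
  assumes "regular_band TYPE('a::{finite, semigroup_mult})"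
  shows "(SMP :: 'a option list set) \<in> class_P"
proof (rule in_class_P_by_program)
  show "Accept \<noteq> Reject"
    by simp
  show "{fst a1, fst a2, fst a3} \<subseteq>
      {Blank} \<union> range Letter \<union> Extra ` {..<card (UNIV :: 'a record_cell set)}"
    if "program q x y z = (q', a1, a2, a3)"
      "{x, y, z} \<subseteq> {Blank} \<union> range Letter \<union> Extra ` {..<card (UNIV :: 'a record_cell set)}"
    for q q' a1 a2 a3 and x y z :: "'a option symbol"
    using program_alphabet that by blast
  show "\<exists>t\<le>poly [:5, 7, 3:] (length w).
      fst ((program_step program Accept Reject ^^ t) (Start, ([], map Letter w), ([], []), ([], []))) =
        (if w \<in> SMP then Accept else Reject)" for w :: "'a option list"
    using program_decides[OF assms, of w] by (simp add: halts_def)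
qed

end
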